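(* Consider the Maxwell-Bloch equations with the rotating wave approximation on $\mathbb{R}^5$, $$\dot x_1=y_1,\quad \dot y_1=x_1z,\quad \dot x_2=y_2,\quad \dot y_2=x_2z,\quad \dot z=-(x_1y_1+x_2y_2),$$ and let $\alpha,\beta,\gamma\in\mathbb{R}$. (i) The vector field $$\mathbf{X}=(-\alpha t+\beta)\frac{\partial}{\partial t}+(\alpha x_1+\gamma x_2)\frac{\partial}{\partial x_1}+(2\alpha y_1+\gamma y_2)\frac{\partial}{\partial y_1}+(-\gamma x_1+\alpha x_2)\frac{\partial}{\partial x_2}+(2\alpha y_2-\gamma y_1)\frac{\partial}{\partial y_2}+2\alpha z\frac{\partial}{\partial z}$$ is a Lie point symmetry of this system. Moreover, it is a conformal symmetry and also a master symmetry. (ii) In the case $\alpha=0$, the vector field $$\mathbf{X}=\beta\frac{\partial}{\partial t}+\gamma x_2\frac{\partial}{\partial x_1}+\gamma y_2\frac{\partial}{\partial y_1}-\gamma x_1\frac{\partial}{\partial x_2}-\gamma y_1\frac{\partial}{\partial y_2}$$ is a symmetry of the system.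
   Context: Write $(u_1,\dots,u_5)=(x_1,y_1,x_2,y_2,z)$. The system is Hamiltonian with respect to the Poisson structure $\pi$ on $\mathbb{R}^5$ whose nonzero brackets of coordinates are (up to antisymmetry) $\{x_1,y_1\}=1$, $\{y_1,z\}=x_1$, $\{x_2,y_2\}=1$, $\{y_2,z\}=x_2$, with Hamiltonian $H=\frac12(y_1^2+y_2^2+z^2)$; its Hamiltonian vector field is $$X_H=y_1\frac{\partial}{\partial x_1}+x_1z\frac{\partial}{\partial y_1}+y_2\frac{\partial}{\partial x_2}+x_2z\frac{\partial}{\partial y_2}-(x_1y_1+x_2y_2)\frac{\partial}{\partial z}.$$ Let $\mathbf{X}=\xi\frac{\partial}{\partial t}+\sum_{i=1}^5\eta_i\frac{\partial}{\partial u_i}$ be a smooth vector field on $\mathbb{R}\times\mathbb{R}^5$ with coordinates $(t,u_1,\dots,u_5)$; the objects $\pi,H,X_H$ are regarded as ($t$-independent) objects on $\mathbb{R}\times\mathbb{R}^5$, brackets are Lie brackets and $\mathcal{L}$ denotes the Lie derivative there, and $\frac{\partial\mathbf{X}}{\partial t}$ is the vector field obtained by differentiating the coefficients of $\mathbf{X}$ with respect to $t$. - $\mathbf{X}$ is a Lie point symmetry if its first prolongation $pr^{(1)}(\mathbf{X})=\mathbf{X}+\sum_i(\dot\eta_i-\dot\xi\dot u_i)\frac{\partial}{\partial\dot u_i}$ (dots on $\xi,\eta_i$ being total time derivatives) annihilates the equations of the system whenever these equations hold. - $\mathbf{X}$ is a conformal symmetry if there are constants $\lambda,\nu\in\mathbb{R}$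 with $\mathcal{L}_{\mathbf{X}}\pi=\lambda\pi$ and $\mathcal{L}_{\mathbf{X}}H=\nu H$. - $\mathbf{X}$ is a master symmetry if $[[\mathbf{X},X_H],X_H]=0$. - $\mathbf{X}$ is a symmetry if $\frac{\partial\mathbf{X}}{\partial t}+[\mathbf{X},X_H]=0$. *)

theory Defs
  imports "HOL-Analysis.Analysis"
begin

section \<open>Smooth functions and vector fields on Euclidean spaces\<close>

primrec Ck :: "nat \<Rightarrow> ('a::euclidean_space \<Rightarrow> 'b::real_normed_vector) \<Rightarrow> bool" where
  "Ck 0 f \<longleftrightarrow> continuous_on UNIV f"
| "Ck (Suc k) f \<longleftrightarrow> (\<forall>p. f differentiable (at p)) \<and>
     (\<forall>v. Ck k (\<lambda>p. frechet_derivative f (at p) v))"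

definition smooth :: "('a::euclidean_space \<Rightarrow> 'b::real_normed_vector) \<Rightarrow> bool" where
  "smooth f \<longleftrightarrow> (\<forall>k. Ck k f)"

text \<open>A vector field on a Euclidean space is a map of the space to itself. The bracket
  has the sign for which it is the commutator of derivations,
  \<open>[X,Y] f = X (Y f) - Y (X f)\<close>.\<close>

definition lie_bracket :: "('a::euclidean_space \<Rightarrow> 'a) \<Rightarrow> ('a \<Rightarrow> 'a) \<Rightarrow> 'a \<Rightarrow> 'a" where
  "lie_bracket X Y p = frechet_derivative Y (at p) (X p) - frechet_derivative X (at p) (Y p)"

definition lie_derivative_fun :: "('a::euclidean_space \<Rightarrow> 'a) \<Rightarrow> ('a \<Rightarrow> real) \<Rightarrow> 'a \<Rightarrow> real" where
  "lie_derivative_fun X f p = frechet_derivative f (at p) (X p)"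

section \<open>Bivector fields\<close>

text \<open>A bivector field \<open>P\<close> assigns to each point \<open>p\<close> a bilinear form \<open>P p\<close> on covectors,
  where covectors are linear functionals; the associated bracket of functions is
  \<open>{f,g}(p) = P p (df\<^sub>p) (dg\<^sub>p)\<close>.\<close>

type_synonym 'a bivector_field = "'a \<Rightarrow> ('a \<Rightarrow> real) \<Rightarrow> ('a \<Rightarrow> real) \<Rightarrow> real"

text \<open>The Leibniz rule
  \<open>(\<L>\<^sub>X P)(a,b) = X (P(a,b)) - P(\<L>\<^sub>X a, b) - P(a, \<L>\<^sub>X b)\<close>, evaluated on constant
  one-forms \<open>a\<close>, \<open>b\<close>, for which \<open>\<L>\<^sub>X a = d (a(X)) = a \<circ> DX\<close>. In coordinates this is
  \<open>X\<^sup>k \<partial>\<^sub>k P\<^sup>i\<^sup>j - P\<^sup>k\<^sup>j \<partial>\<^sub>k X\<^sup>i - P\<^sup>i\<^sup>k \<partial>\<^sub>k X\<^sup>j\<close>.\<close>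

definition lie_derivative_bivector ::
    "('a::euclidean_space \<Rightarrow> 'a) \<Rightarrow> 'a bivector_field \<Rightarrow> 'a bivector_field" where
  "lie_derivative_bivector X P p a b =
     frechet_derivative (\<lambda>q. P q a b) (at p) (X p)
     - P p (a \<circ> frechet_derivative X (at p)) b
     - P p a (b \<circ> frechet_derivative X (at p))"

text \<open>The vector field determined by \<open>a(X\<^sub>H) = P(a, dH)\<close>, i.e. with coordinates
  \<open>{u\<^sub>i, H}\<close>.\<close>

definition hamiltonian_vf ::
    "'a::euclidean_space bivector_field \<Rightarrow> ('a \<Rightarrow> real) \<Rightarrow> 'a \<Rightarrow> 'a" where
  "hamiltonian_vf P H p =
     (\<Sum>e\<in>Basis. P p (\<lambda>v. v \<bullet> e) (frechet_derivative H (at p)) *\<^sub>R e)"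

section \<open>Time-independent objects on extended phase space\<close>

definition ext_fun :: "('a \<Rightarrow> real) \<Rightarrow> real \<times> 'a \<Rightarrow> real" where
  "ext_fun f = (\<lambda>(t, u). f u)"

definition ext_vf :: "('a::euclidean_space \<Rightarrow> 'a) \<Rightarrow> real \<times> 'a \<Rightarrow> real \<times> 'a" where
  "ext_vf Y = (\<lambda>(t, u). (0, Y u))"

definition ext_bivector :: "'a::euclidean_space bivector_field \<Rightarrow> (real \<times> 'a) bivector_field" where
  "ext_bivector P = (\<lambda>(t, u) a b. P u (\<lambda>v. a (0, v)) (\<lambda>v. b (0, v)))"

definition time_deriv_vf :: "(real \<times> 'a \<Rightarrow> real \<times> 'a::euclidean_space) \<Rightarrow> real \<times> 'a \<Rightarrow> real \<times> 'a" where
  "time_deriv_vf X = (\<lambda>(t, u). vector_derivative (\<lambda>s. X (s, u)) (at t))"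

section \<open>The four kinds of symmetry\<close>

text \<open>Points \<open>(t, u, w)\<close> of the first jet space have \<open>w\<close> in the role of the derivative
  of \<open>u\<close>.\<close>

definition total_time_deriv ::
    "(real \<times> 'a::euclidean_space \<Rightarrow> 'b::real_normed_vector) \<Rightarrow> real \<times> 'a \<times> 'a \<Rightarrow> 'b" where
  "total_time_deriv f = (\<lambda>(t, u, w). frechet_derivative f (at (t, u)) (1, w))"

definition first_prolongation ::
    "(real \<times> 'a::euclidean_space \<Rightarrow> real \<times> 'a) \<Rightarrow> real \<times> 'a \<times> 'a \<Rightarrow> real \<times> 'a \<times> 'a" where
  "first_prolongation X = (\<lambda>(t, u, w).
     (fst (X (t, u)), snd (X (t, u)),
      total_time_deriv (\<lambda>q. snd (X q)) (t, u, w)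
      - total_time_deriv (\<lambda>q. fst (X q)) (t, u, w) *\<^sub>R w))"

definition ode_equation :: "('a::euclidean_space \<Rightarrow> 'a) \<Rightarrow> real \<times> 'a \<times> 'a \<Rightarrow> 'a" where
  "ode_equation F = (\<lambda>(t, u, w). w - F u)"

definition is_lie_point_symmetry ::
    "('a::euclidean_space \<Rightarrow> 'a) \<Rightarrow> (real \<times> 'a \<Rightarrow> real \<times> 'a) \<Rightarrow> bool" where
  "is_lie_point_symmetry F X \<longleftrightarrow> smooth X \<and>
     (\<forall>j. ode_equation F j = 0 \<longrightarrow>
        frechet_derivative (ode_equation F) (at j) (first_prolongation X j) = 0)"

definition is_conformal_symmetry ::
    "'a::euclidean_space bivector_field \<Rightarrow> ('a \<Rightarrow> real) \<Rightarrow> (real \<times> 'a \<Rightarrow> real \<times> 'a) \<Rightarrow> bool" where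
  "is_conformal_symmetry P H X \<longleftrightarrow> smooth X \<and>
     (\<exists>c \<nu>.
        (\<forall>p a b. linear a \<longrightarrow> linear b \<longrightarrow>
           lie_derivative_bivector X (ext_bivector P) p a b = c * ext_bivector P p a b) \<and>
        (\<forall>p. lie_derivative_fun X (ext_fun H) p = \<nu> * ext_fun H p))"

definition is_master_symmetry ::
    "('a::euclidean_space \<Rightarrow> 'a) \<Rightarrow> (real \<times> 'a \<Rightarrow> real \<times> 'a) \<Rightarrow> bool" where
  "is_master_symmetry Y X \<longleftrightarrow> smooth X \<and>
     (\<forall>p. lie_bracket (lie_bracket X (ext_vf Y)) (ext_vf Y) p = 0)"

definition is_symmetry ::
    "('a::euclidean_space \<Rightarrow> 'a) \<Rightarrow> (real \<times> 'a \<Rightarrow> real \<times> 'a) \<Rightarrow> bool" where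
  "is_symmetry Y X \<longleftrightarrow> smooth X \<and>
     (\<forall>p. time_deriv_vf X p + lie_bracket X (ext_vf Y) p = 0)"

section \<open>The Maxwell-Bloch system\<close>

text \<open>Coordinates \<open>(u$1, \<dots>, u$5) = (x\<^sub>1, y\<^sub>1, x\<^sub>2, y\<^sub>2, z)\<close>.\<close>

definition mb_rhs :: "real^5 \<Rightarrow> real^5" where
  "mb_rhs u = vector [u$2, u$1 * u$5, u$4, u$3 * u$5, - (u$1 * u$2 + u$3 * u$4)]"

text \<open>Row \<open>i\<close>, column \<open>j\<close> is the bracket \<open>{u\<^sub>i, u\<^sub>j}\<close>.\<close>

definition mb_poisson_matrix :: "real^5 \<Rightarrow> real^5^5" where
  "mb_poisson_matrix u = vector
     [vector [  0,      1,  0,      0,   0 ],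
      vector [ -1,      0,  0,      0,  u$1],
      vector [  0,      0,  0,      1,   0 ],
      vector [  0,      0, -1,      0,  u$3],
      vector [  0,  - u$1,  0,  - u$3,   0 ]]"

definition mb_poisson :: "(real^5) bivector_field" where
  "mb_poisson u a b =
     (\<Sum>i\<in>UNIV. \<Sum>j\<in>UNIV. mb_poisson_matrix u $ i $ j * a (axis i 1) * b (axis j 1))"

definition mb_hamiltonian :: "real^5 \<Rightarrow> real" where
  "mb_hamiltonian u = ((u$2)\<^sup>2 + (u$4)\<^sup>2 + (u$5)\<^sup>2) / 2"

definition mb_hamiltonian_vf :: "real^5 \<Rightarrow> real^5" where
  "mb_hamiltonian_vf = hamiltonian_vf mb_poisson mb_hamiltonian"

lemma vector_5:
  "(vector [a, b, c, d, e] :: 'a::zero^5) $ 1 = a"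
  "(vector [a, b, c, d, e] :: 'a::zero^5) $ 2 = b"
  "(vector [a, b, c, d, e] :: 'a::zero^5) $ 3 = c"
  "(vector [a, b, c, d, e] :: 'a::zero^5) $ 4 = d"
  "(vector [a, b, c, d, e] :: 'a::zero^5) $ 5 = e"
  unfolding vector_def by simp_all

lemma exhaust_5:
  fixes i :: 5
  shows "i = 1 \<or> i = 2 \<or> i = 3 \<or> i = 4 \<or> i = 5"
proof (induct i)
  case (of_int z)
  then have "z = 0 \<or> z = 1 \<or> z = 2 \<or> z = 3 \<or> z = 4" by auto
  then show ?case by auto
qed

lemma UNIV_5: "UNIV = {1, 2, 3, 4, 5::5}"
  using exhaust_5 by auto

lemma sum_5: "sum f (UNIV :: 5 set) = f 1 + f 2 + f 3 + f 4 + f 5"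
  unfolding UNIV_5 by (simp add: ac_simps)

text \<open>The Hamiltonian vector field of the data above is the right-hand side of the
  Maxwell-Bloch equations.\<close>

lemma mb_hamiltonian_vf_eq: "mb_hamiltonian_vf = mb_rhs"
proof
  fix u :: "real^5"
  have axis_nth: "axis i c $ j = (if j = i then c else 0)" for i j :: 5 and c :: real
    by (simp add: axis_def)
  have "(mb_hamiltonian has_derivative (\<lambda>h. u$2 * h$2 + u$4 * h$4 + u$5 * h$5)) (at u)"
    unfolding mb_hamiltonian_def power2_eq_square
    by (auto intro!: derivative_eq_intros
        bounded_linear_imp_has_derivative[OF bounded_linear_vec_nth] simp: field_simps)
  then have dH: "frechet_derivative mb_hamiltonian (at u)
      = (\<lambda>h. u$2 * h$2 + u$4 * h$4 + u$5 * h$5)"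
    by (rule frechet_derivative_at[symmetric])
  show "mb_hamiltonian_vf u = mb_rhs u"
    unfolding vec_eq_iff
  proof
    fix i :: 5
    have "mb_hamiltonian_vf u $ i = mb_hamiltonian_vf u \<bullet> axis i 1"
      by (simp add: inner_axis)
    also have "\<dots> = mb_poisson u (\<lambda>v. v \<bullet> axis i 1) (frechet_derivative mb_hamiltonian (at u))"
      unfolding mb_hamiltonian_vf_def hamiltonian_vf_def
      by (simp add: inner_sum_left inner_Basis axis_in_Basis_iff if_distrib[where f="\<lambda>r. _ * r"] cong: if_cong)
    also have "\<dots> = mb_rhs u $ i"
      unfolding dH mb_poisson_def
      using exhaust_5[of i]
      by (auto simp: sum_5 inner_axis axis_nth mb_poisson_matrix_def vector_5 mb_rhs_def)
    finally show "mb_hamiltonian_vf u $ i = mb_rhs u $ i" .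
  qed
qed

end

theory Submission
  imports Defs
begin

text \<open>
  The vector field is the sum of a time translation, a rotation of the pair \<open>(x, y)\<^sub>1\<close> into
  the pair \<open>(x, y)\<^sub>2\<close> with rate \<open>\<gamma>\<close>, and a weighted dilation with rate \<open>\<alpha>\<close> in which \<open>x\<^sub>1, x\<^sub>2\<close>
  have weight 1, the variables \<open>y\<^sub>1, y\<^sub>2, z\<close> have weight 2, and \<open>t\<close> has weight \<open>-1\<close>.
  The Maxwell-Bloch equations are invariant under the rotation and weighted homogeneous for
  the dilation: every component \<open>F\<^sub>i\<close> of the right-hand side has weight one more than the
  coordinate \<open>u\<^sub>i\<close>. With \<open>B\<close> the linear map of phase space that generates rotation and
  dilation, this says

    \<open>[B, F] = DF (B u) - B (F u) = \<alpha> F\<close>   (lemma \<open>mb_weighted_homogeneity\<close>).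

  Three of the four claims are consequences of this one identity, for an arbitrary
  system \<open>F\<close> and an arbitrary linear \<open>B\<close>. On extended phase space the field is
  \<open>X = (- \<alpha> t + \<beta>) \<partial>\<^sub>t + B\<close>, and the time part does not interact with the autonomous field \<open>F\<close>.
  Hence \<open>[X, F] = \<alpha> F\<close>, which commutes with \<open>F\<close> and makes \<open>X\<close> a master symmetry, and for
  \<open>\<alpha> = 0\<close> the bracket vanishes and \<open>X\<close> does not depend on \<open>t\<close>, which makes it a symmetry.
  Along solutions, the acceleration by \<open>\<alpha> F\<close> is compensated exactly by the
  rescaling of time with rate \<open>- \<alpha>\<close>, which makes \<open>X\<close> a Lie point symmetry.

  The conformal property is again a count of weights: rotations preserve both \<open>\<pi>\<close> and \<open>H\<close>;
  the function \<open>H\<close> has weight 4, and each entry \<open>{u\<^sub>i, u\<^sub>j}\<close> of \<open>\<pi>\<close> has weight 3 less than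
  \<open>u\<^sub>i u\<^sub>j\<close>. So the conformal factors are \<open>- 3 \<alpha>\<close> for \<open>\<pi>\<close> and \<open>4 \<alpha>\<close> for \<open>H\<close>.
\<close>

section \<open>Affine maps are smooth\<close>

lemma Ck_const: "Ck k (\<lambda>p. c)"
  by (induction k arbitrary: c) (simp_all add: frechet_derivative_const)

lemma smooth_affine:
  fixes f :: "'a::euclidean_space \<Rightarrow> 'b::real_normed_vector"
  assumes "\<And>p. (f has_derivative L) (at p)"
  shows "smooth f"
proof -
  have "frechet_derivative f (at p) = L" for p
    by (rule frechet_derivative_at[OF assms, symmetric])
  moreover have "f differentiable (at p)" for p
    by (rule differentiableI[OF assms])
  ultimately have "Ck (Suc k) f" for k
    by (simp add: Ck_const)
  moreover have "Ck 0 f"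
    by (simp add: continuous_at_imp_continuous_on has_derivative_continuous[OF assms])
  ultimately show ?thesis
    unfolding smooth_def by (metis not0_implies_Suc)
qed

section \<open>Fields whose time and space parts decouple\<close>

text \<open>For linear \<open>B\<close>, the flow of this field rescales and translates time and, independently
  of that, acts linearly on phase space.\<close>

definition affine_time_field :: "real \<Rightarrow> real \<Rightarrow> ('a \<Rightarrow> 'a) \<Rightarrow> real \<times> 'a \<Rightarrow> real \<times> 'a" where
  "affine_time_field c \<beta> B = (\<lambda>(t, u). (c * t + \<beta>, B u))"

lemma has_derivative_ext_fun:
  assumes "(f has_derivative f') (at u)"
  shows "(ext_fun f has_derivative (\<lambda>q. f' (snd q))) (at (t, u))"
  unfolding ext_fun_def case_prod_beta
  by (rule has_derivative_compose[of snd snd "(t, u)" UNIV f f'])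
    (use assms in \<open>auto intro!: derivative_eq_intros\<close>)

lemma has_derivative_ext_vf:
  assumes "(F has_derivative F') (at u)"
  shows "(ext_vf F has_derivative (\<lambda>q. (0, F' (snd q)))) (at (t, u))"
proof -
  have "((\<lambda>q. F (snd q)) has_derivative (\<lambda>q. F' (snd q))) (at (t, u))"
    by (rule has_derivative_compose[of snd snd "(t, u)" UNIV F F'])
      (use assms in \<open>auto intro!: derivative_eq_intros\<close>)
  then show ?thesis
    unfolding ext_vf_def case_prod_beta by (intro has_derivative_Pair has_derivative_const)
qed

context
  fixes B :: "'a::euclidean_space \<Rightarrow> 'a" and c \<beta> :: real
  assumes B: "linear B"
begin

lemma has_derivative_linear_part: "(B has_derivative B) (at u)"
  using B by (rule linear_imp_has_derivative)

lemma has_derivative_affine_time_field: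
  "(affine_time_field c \<beta> B has_derivative (\<lambda>q. (c * fst q, B (snd q)))) (at p)"
proof -
  have "((\<lambda>q. B (snd q)) has_derivative (\<lambda>q. B (snd q))) (at p)"
    by (rule has_derivative_compose[of snd snd p UNIV B B])
      (auto intro!: derivative_eq_intros has_derivative_linear_part)
  moreover have "((\<lambda>q. c * fst q + \<beta>) has_derivative (\<lambda>q. c * fst q)) (at p)"
    by (auto intro!: derivative_eq_intros)
  ultimately show ?thesis
    unfolding affine_time_field_def case_prod_beta by (intro has_derivative_Pair)
qed

lemma smooth_affine_time_field: "smooth (affine_time_field c \<beta> B)"
  by (rule smooth_affine[OF has_derivative_affine_time_field])

lemma frechet_derivative_affine_time_field:
  "frechet_derivative (affine_time_field c \<beta> B) (at p) = (\<lambda>q. (c * fst q, B (snd q)))"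
  by (rule frechet_derivative_at[OF has_derivative_affine_time_field, symmetric])

lemma lie_bracket_affine_time_field:
  assumes "(F has_derivative F') (at u)"
  shows "lie_bracket (affine_time_field c \<beta> B) (ext_vf F) (t, u) = (0, F' (B u) - B (F u))"
proof -
  have "frechet_derivative (ext_vf F) (at (t, u)) = (\<lambda>q. (0, F' (snd q)))"
    by (simp add: frechet_derivative_at[OF has_derivative_ext_vf[OF assms], symmetric])
  then show ?thesis
    by (simp add: lie_bracket_def frechet_derivative_affine_time_field)
      (simp add: affine_time_field_def ext_vf_def)
qed

lemma time_deriv_affine_time_field:
  "time_deriv_vf (affine_time_field c \<beta> B) (t, u) = (c, 0)"
proof -
  have "((\<lambda>s. (c * s + \<beta>, B u)) has_vector_derivative (c, 0)) (at t)"
    unfolding has_vector_derivative_def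
    by (auto intro!: derivative_eq_intros)
  then show ?thesis
    by (simp add: time_deriv_vf_def affine_time_field_def vector_derivative_at)
qed

lemma lie_derivative_fun_affine_time_field:
  assumes "(f has_derivative f') (at u)"
  shows "lie_derivative_fun (affine_time_field c \<beta> B) (ext_fun f) (t, u) = f' (B u)"
  using frechet_derivative_at[OF has_derivative_ext_fun[OF assms, of t], symmetric]
  by (simp add: lie_derivative_fun_def affine_time_field_def)

text \<open>A time-independent bivector only sees the spatial part of a covector. Since the
  derivative of the field is block diagonal, this part is transformed by \<open>B\<close> alone, so
  that the time direction drops out of the Lie derivative.\<close>

lemma lie_derivative_bivector_affine_time_field:
  assumes "(\<lambda>v. P v (\<lambda>v. a (0, v)) (\<lambda>v. b (0, v))) differentiable (at u)"
  shows "lie_derivative_bivector (affine_time_field c \<beta> B) (ext_bivector P) (t, u) a b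
    = lie_derivative_bivector B P u (\<lambda>v. a (0, v)) (\<lambda>v. b (0, v))"
proof -
  let ?f = "\<lambda>v. P v (\<lambda>v. a (0, v)) (\<lambda>v. b (0, v))"
  have ext: "(\<lambda>q. ext_bivector P q a b) = ext_fun ?f"
    by (auto simp: ext_bivector_def ext_fun_def)
  have "(?f has_derivative frechet_derivative ?f (at u)) (at u)"
    using assms by (simp add: frechet_derivative_works)
  from frechet_derivative_at[OF has_derivative_ext_fun[OF this, of t], symmetric]
  have "frechet_derivative (\<lambda>q. ext_bivector P q a b) (at (t, u))
      (affine_time_field c \<beta> B (t, u)) = frechet_derivative ?f (at u) (B u)"
    by (simp add: ext affine_time_field_def)
  moreover have "frechet_derivative B (at u) = B"
    by (simp add: frechet_derivative_at[OF has_derivative_linear_part, symmetric])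
  ultimately show ?thesis
    unfolding lie_derivative_bivector_def frechet_derivative_affine_time_field
    by (simp add: ext_bivector_def comp_def)
qed

section \<open>Symmetries from the commutation relation with the system\<close>

text \<open>On solutions \<open>w = F u\<close>, and there the prolonged velocity component is
  \<open>B w - c w\<close>: the rescaling of time contributes the term \<open>- c w\<close>. The hypothesis says that
  this is the change of \<open>F\<close> along the field.\<close>

lemma is_lie_point_symmetry_affine_time_field:
  assumes F: "\<And>u. (F has_derivative F' u) (at u)"
    and comm: "\<And>u. F' u (B u) - B (F u) = - c *\<^sub>R F u"
  shows "is_lie_point_symmetry F (affine_time_field c \<beta> B)"
  unfolding is_lie_point_symmetry_def
proof (intro conjI allI impI smooth_affine_time_field)
  fix j :: "real \<times> 'a \<times> 'a"
  assume eq: "ode_equation F j = 0"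
  obtain t u w where j: "j = (t, u, w)" by (metis prod_cases3)
  have w: "w = F u"
    using eq by (simp add: j ode_equation_def)
  have "((\<lambda>q. F (fst (snd q))) has_derivative (\<lambda>q. F' u (fst (snd q)))) (at j)"
    by (rule has_derivative_compose[of "\<lambda>q. fst (snd q)" "\<lambda>q. fst (snd q)" j UNIV F "F' u"])
      (auto simp: j intro!: derivative_eq_intros F)
  then have "(ode_equation F has_derivative (\<lambda>q. snd (snd q) - F' u (fst (snd q)))) (at j)"
    unfolding ode_equation_def case_prod_beta
    by (auto intro!: derivative_eq_intros)
  then have D: "frechet_derivative (ode_equation F) (at j)
      = (\<lambda>q. snd (snd q) - F' u (fst (snd q)))"
    by (rule frechet_derivative_at[symmetric])
  note DX = has_derivative_affine_time_field[of "(t, u)"]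
  have "frechet_derivative (\<lambda>q. fst (affine_time_field c \<beta> B q)) (at (t, u)) = (\<lambda>q. c * fst q)"
    by (simp add: frechet_derivative_at[OF has_derivative_fst[OF DX], symmetric])
  moreover have
    "frechet_derivative (\<lambda>q. snd (affine_time_field c \<beta> B q)) (at (t, u)) = (\<lambda>q. B (snd q))"
    by (simp add: frechet_derivative_at[OF has_derivative_snd[OF DX], symmetric])
  ultimately have "first_prolongation (affine_time_field c \<beta> B) j
      = (c * t + \<beta>, B u, B w - c *\<^sub>R w)"
    by (simp add: j first_prolongation_def total_time_deriv_def affine_time_field_def)
  then show "frechet_derivative (ode_equation F) (at j)
      (first_prolongation (affine_time_field c \<beta> B) j) = 0"
    using comm[of u] by (simp add: D w algebra_simps)
qed

text \<open>If \<open>[X, F]\<close> is a constant multiple of \<open>F\<close>, it commutes with \<open>F\<close>.\<close>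

lemma is_master_symmetry_affine_time_field:
  assumes F: "\<And>u. (F has_derivative F' u) (at u)"
    and comm: "\<And>u. F' u (B u) - B (F u) = k *\<^sub>R F u"
  shows "is_master_symmetry F (affine_time_field c \<beta> B)"
  unfolding is_master_symmetry_def
proof (intro conjI allI smooth_affine_time_field)
  fix p :: "real \<times> 'a"
  obtain t u where p: "p = (t, u)" by force
  have br: "lie_bracket (affine_time_field c \<beta> B) (ext_vf F) = ext_vf (\<lambda>u. k *\<^sub>R F u)"
    by (rule ext)
      (auto simp: lie_bracket_affine_time_field[OF F] comm ext_vf_def[of "\<lambda>u. k *\<^sub>R F u"])
  have lin: "linear (F' u)"
    using has_derivative_linear[OF F] .
  have DF: "frechet_derivative (ext_vf F) (at p) = (\<lambda>q. (0, F' u (snd q)))"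
    unfolding p by (simp add: frechet_derivative_at[OF has_derivative_ext_vf[OF F], symmetric])
  have DkF: "frechet_derivative (ext_vf (\<lambda>u. k *\<^sub>R F u)) (at p) = (\<lambda>q. (0, k *\<^sub>R F' u (snd q)))"
    unfolding p
    by (simp add: frechet_derivative_at[OF has_derivative_ext_vf[OF
            has_derivative_scaleR_right[OF F]], symmetric])
  show "lie_bracket (lie_bracket (affine_time_field c \<beta> B) (ext_vf F)) (ext_vf F) p = 0"
    unfolding br lie_bracket_def DF DkF
    by (simp add: p zero_prod_def ext_vf_def linear_scale[OF lin])
qed

end

lemma is_symmetry_affine_time_field:
  assumes B: "linear B"
    and F: "\<And>u. (F has_derivative F' u) (at u)"
    and comm: "\<And>u. F' u (B u) = B (F u)"
  shows "is_symmetry F (affine_time_field 0 \<beta> B)"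
  by (auto simp: is_symmetry_def zero_prod_def smooth_affine_time_field[OF B] comm
      time_deriv_affine_time_field[OF B] lie_bracket_affine_time_field[OF B F])

section \<open>Dilation and rotation of the Maxwell-Bloch system\<close>

definition dilation_rotation :: "real \<Rightarrow> real \<Rightarrow> real^5 \<Rightarrow> real^5" where
  "dilation_rotation \<alpha> \<gamma> u = vector
     [\<alpha> * u$1 + \<gamma> * u$3, 2 * \<alpha> * u$2 + \<gamma> * u$4, - \<gamma> * u$1 + \<alpha> * u$3,
      2 * \<alpha> * u$4 - \<gamma> * u$2, 2 * \<alpha> * u$5]"

lemma vec5_eqI:
  fixes u v :: "'a^5"
  assumes "u$1 = v$1" "u$2 = v$2" "u$3 = v$3" "u$4 = v$4" "u$5 = v$5"
  shows "u = v"
  unfolding vec_eq_iff using assms exhaust_5 by metis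

lemma linear_dilation_rotation: "linear (dilation_rotation \<alpha> \<gamma>)"
  by (rule linearI; rule vec5_eqI)
    (simp_all add: dilation_rotation_def vector_5 algebra_simps)

definition mb_rhs_deriv :: "real^5 \<Rightarrow> real^5 \<Rightarrow> real^5" where
  "mb_rhs_deriv u h = vector [h$2, u$1 * h$5 + h$1 * u$5, h$4, u$3 * h$5 + h$3 * u$5,
     - (u$1 * h$2 + h$1 * u$2 + u$3 * h$4 + h$3 * u$4)]"

lemmas has_derivative_vec_nth =
  bounded_linear_imp_has_derivative[OF bounded_linear_vec_nth]

lemma has_derivative_mb_rhs: "(mb_rhs has_derivative mb_rhs_deriv u) (at u)"
proof -
  have prod: "((\<lambda>u. u$j * u$k) has_derivative (\<lambda>h. u$j * h$k + h$j * u$k)) (at u)" for j k :: 5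
    by (intro has_derivative_mult has_derivative_vec_nth)
  have "((\<lambda>u. mb_rhs u $ i) has_derivative (\<lambda>h. mb_rhs_deriv u h $ i)) (at u)" for i
    using exhaust_5[of i] prod[of 1 5] prod[of 3 5]
      has_derivative_minus[OF has_derivative_add[OF prod[of 1 2] prod[of 3 4]]]
    by (auto simp: mb_rhs_def mb_rhs_deriv_def vector_5 algebra_simps has_derivative_vec_nth)
  then show ?thesis
    by (simp add: has_derivative_componentwise_within[of mb_rhs] Basis_vec_def inner_axis)
qed

text \<open>Each term of an equation has the weight of its variable plus one, the weight of
  \<open>d/dt\<close>: for instance \<open>x\<^sub>1 z\<close> has weight 3, while \<open>y\<^sub>1\<close> has weight 2. The terms with \<open>\<gamma>\<close>
  cancel by the equivariance of the system under rotations.\<close>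

lemma mb_weighted_homogeneity:
  "mb_rhs_deriv u (dilation_rotation \<alpha> \<gamma> u) - dilation_rotation \<alpha> \<gamma> (mb_rhs u) = \<alpha> *\<^sub>R mb_rhs u"
  by (rule vec5_eqI)
    (simp_all add: dilation_rotation_def mb_rhs_def mb_rhs_deriv_def vector_5 algebra_simps)

lemma has_derivative_mb_hamiltonian:
  "(mb_hamiltonian has_derivative (\<lambda>h. u$2 * h$2 + u$4 * h$4 + u$5 * h$5)) (at u)"
  unfolding mb_hamiltonian_def power2_eq_square
  by (auto intro!: derivative_eq_intros has_derivative_vec_nth simp: field_simps)

lemma mb_hamiltonian_weight:
  "u$2 * dilation_rotation \<alpha> \<gamma> u $ 2 + u$4 * dilation_rotation \<alpha> \<gamma> u $ 4
     + u$5 * dilation_rotation \<alpha> \<gamma> u $ 5 = (4 * \<alpha>) * mb_hamiltonian u"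
  by (simp add: dilation_rotation_def mb_hamiltonian_def vector_5 field_simps power2_eq_square)

lemma mb_poisson_expand:
  "mb_poisson u a b =
     (a (axis 1 1) * b (axis 2 1) - a (axis 2 1) * b (axis 1 1))
     + (a (axis 3 1) * b (axis 4 1) - a (axis 4 1) * b (axis 3 1))
     + u$1 * (a (axis 2 1) * b (axis 5 1) - a (axis 5 1) * b (axis 2 1))
     + u$3 * (a (axis 4 1) * b (axis 5 1) - a (axis 5 1) * b (axis 4 1))"
  by (simp add: mb_poisson_def sum_5 mb_poisson_matrix_def vector_5 algebra_simps)

lemma has_derivative_mb_poisson:
  "((\<lambda>u. mb_poisson u a b) has_derivative
     (\<lambda>h. h$1 * (a (axis 2 1) * b (axis 5 1) - a (axis 5 1) * b (axis 2 1))
        + h$3 * (a (axis 4 1) * b (axis 5 1) - a (axis 5 1) * b (axis 4 1)))) (at u)"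
  unfolding mb_poisson_expand
  by (auto intro!: derivative_eq_intros has_derivative_vec_nth)

text \<open>The columns of the matrix of the linear field, which express the pulled-back
  covectors in coordinates.\<close>

lemma dilation_rotation_axis:
  "dilation_rotation \<alpha> \<gamma> (axis 1 1) = \<alpha> *\<^sub>R axis 1 1 - \<gamma> *\<^sub>R axis 3 1"
  "dilation_rotation \<alpha> \<gamma> (axis 2 1) = (2 * \<alpha>) *\<^sub>R axis 2 1 - \<gamma> *\<^sub>R axis 4 1"
  "dilation_rotation \<alpha> \<gamma> (axis 3 1) = \<gamma> *\<^sub>R axis 1 1 + \<alpha> *\<^sub>R axis 3 1"
  "dilation_rotation \<alpha> \<gamma> (axis 4 1) = \<gamma> *\<^sub>R axis 2 1 + (2 * \<alpha>) *\<^sub>R axis 4 1"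
  "dilation_rotation \<alpha> \<gamma> (axis 5 1) = (2 * \<alpha>) *\<^sub>R axis 5 1"
  by (rule vec5_eqI; simp add: dilation_rotation_def vector_5 axis_def)+

text \<open>The dilation acts on the entries \<open>{x\<^sub>i, y\<^sub>i} = 1\<close> with factor \<open>0 - (1 + 2) = - 3\<close> and on
  \<open>{y\<^sub>i, z} = x\<^sub>i\<close> with factor \<open>1 - (2 + 2) = - 3\<close>; it is this agreement that makes \<open>\<pi>\<close>
  conformally invariant.\<close>

lemma mb_poisson_weight:
  assumes a: "linear a" and b: "linear b"
  shows "lie_derivative_bivector (dilation_rotation \<alpha> \<gamma>) mb_poisson u a b
    = (- 3 * \<alpha>) * mb_poisson u a b"
proof -
  have DB: "frechet_derivative (dilation_rotation \<alpha> \<gamma>) (at u) = dilation_rotation \<alpha> \<gamma>"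
    by (rule frechet_derivative_at[OF has_derivative_linear_part[OF linear_dilation_rotation],
          symmetric])
  note D\<pi> = frechet_derivative_at[OF has_derivative_mb_poisson[of a b u], symmetric]
  have coords: "dilation_rotation \<alpha> \<gamma> u $ 1 = \<alpha> * u$1 + \<gamma> * u$3"
    "dilation_rotation \<alpha> \<gamma> u $ 3 = - \<gamma> * u$1 + \<alpha> * u$3"
    by (simp_all add: dilation_rotation_def vector_5)
  show ?thesis
    unfolding lie_derivative_bivector_def DB D\<pi>
    unfolding coords mb_poisson_expand comp_def
      dilation_rotation_axis linear_add[OF a] linear_diff[OF a] linear_scale[OF a]
      linear_add[OF b] linear_diff[OF b] linear_scale[OF b]
    by (simp add: algebra_simps)
qed

lemma is_conformal_symmetry_dilation_rotation:
  "is_conformal_symmetry mb_poisson mb_hamiltonian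
     (affine_time_field c \<beta> (dilation_rotation \<alpha> \<gamma>))"
  unfolding is_conformal_symmetry_def
proof (intro conjI exI allI impI smooth_affine_time_field linear_dilation_rotation)
  fix p :: "real \<times> (real^5)" and a b :: "real \<times> (real^5) \<Rightarrow> real"
  assume ab: "linear a" "linear b"
  obtain t u where p: "p = (t, u)" by force
  have spatial: "linear (\<lambda>v. f (0, v))" if "linear f" for f :: "real \<times> (real^5) \<Rightarrow> real"
  proof (rule linearI)
    show "f (0, v + w) = f (0, v) + f (0, w)" for v w
      using linear_add[OF that, of "(0, v)" "(0, w)"] by simp
    show "f (0, r *\<^sub>R v) = r *\<^sub>R f (0, v)" for r v
      using linear_scale[OF that, of r "(0, v)"] by simp
  qed
  have "lie_derivative_bivector (affine_time_field c \<beta> (dilation_rotation \<alpha> \<gamma>))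
      (ext_bivector mb_poisson) (t, u) a b
    = lie_derivative_bivector (dilation_rotation \<alpha> \<gamma>) mb_poisson u
        (\<lambda>v. a (0, v)) (\<lambda>v. b (0, v))"
    by (intro lie_derivative_bivector_affine_time_field linear_dilation_rotation)
      (rule differentiableI, rule has_derivative_mb_poisson)
  also have "\<dots> = (- 3 * \<alpha>) * mb_poisson u (\<lambda>v. a (0, v)) (\<lambda>v. b (0, v))"
    using ab by (intro mb_poisson_weight spatial)
  finally show "lie_derivative_bivector (affine_time_field c \<beta> (dilation_rotation \<alpha> \<gamma>))
      (ext_bivector mb_poisson) p a b = (- 3 * \<alpha>) * ext_bivector mb_poisson p a b"
    by (simp add: p ext_bivector_def)
next
  fix p :: "real \<times> (real^5)"
  obtain t u where p: "p = (t, u)" by force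
  show "lie_derivative_fun (affine_time_field c \<beta> (dilation_rotation \<alpha> \<gamma>))
      (ext_fun mb_hamiltonian) p = (4 * \<alpha>) * ext_fun mb_hamiltonian p"
    using lie_derivative_fun_affine_time_field[OF linear_dilation_rotation
        has_derivative_mb_hamiltonian, of c \<beta> \<alpha> \<gamma> t u] mb_hamiltonian_weight
    by (simp add: p ext_fun_def)
qed

theorem proposition3p5:
  fixes \<alpha> \<beta> \<gamma> :: real
  shows
    "(let X = (\<lambda>(t, u :: real^5).
           (- \<alpha> * t + \<beta>,
            vector [\<alpha> * u$1 + \<gamma> * u$3,
                    2 * \<alpha> * u$2 + \<gamma> * u$4,
                    - \<gamma> * u$1 + \<alpha> * u$3,
                    2 * \<alpha> * u$4 - \<gamma> * u$2,
                    2 * \<alpha> * u$5]))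
      in is_lie_point_symmetry mb_rhs X \<and>
         is_conformal_symmetry mb_poisson mb_hamiltonian X \<and>
         is_master_symmetry mb_hamiltonian_vf X) \<and>
     is_symmetry mb_hamiltonian_vf
       (\<lambda>(t, u :: real^5).
          (\<beta>, vector [\<gamma> * u$3, \<gamma> * u$4, - \<gamma> * u$1, - \<gamma> * u$2, 0]))"
proof -
  let ?X = "affine_time_field (- \<alpha>) \<beta> (dilation_rotation \<alpha> \<gamma>)"
  have "is_lie_point_symmetry mb_rhs ?X"
    by (rule is_lie_point_symmetry_affine_time_field[OF linear_dilation_rotation
          has_derivative_mb_rhs]) (simp add: mb_weighted_homogeneity)
  moreover have "is_conformal_symmetry mb_poisson mb_hamiltonian ?X"
    by (rule is_conformal_symmetry_dilation_rotation)
  moreover have "is_master_symmetry mb_hamiltonian_vf ?X"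
    unfolding mb_hamiltonian_vf_eq
    by (rule is_master_symmetry_affine_time_field[OF linear_dilation_rotation
          has_derivative_mb_rhs mb_weighted_homogeneity])
  moreover have "is_symmetry mb_hamiltonian_vf (affine_time_field 0 \<beta> (dilation_rotation 0 \<gamma>))"
    unfolding mb_hamiltonian_vf_eq
    by (rule is_symmetry_affine_time_field[OF linear_dilation_rotation has_derivative_mb_rhs])
      (use mb_weighted_homogeneity[of _ 0 \<gamma>] in simp)
  ultimately show ?thesis
    by (simp add: affine_time_field_def dilation_rotation_def Let_def)
qed

end
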